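(* Let $\mathcal{C}$ be a model category, let $\mathcal{C}_{cf}$ be its full subcategory of fibrant-cofibrant objects, and let $\mathcal{W}$ be the family of weak equivalences between objects of $\mathcal{C}_{cf}$. Then $\sim_{\mathcal{W}}$ is the unique congruence in $\mathcal{C}_{cf}$ such that the induced functor $\mathcal{C}_{cf}/{\sim_{\mathcal{W}}}\to Ho(\mathcal{C}_{cf})$ is an isomorphism of categories.
   Context: $\gamma:\mathcal{C}_{cf}\to Ho(\mathcal{C}_{cf})$ denotes the localization of $\mathcal{C}_{cf}$ with respect to $\mathcal{W}$: it sends arrows of $\mathcal{W}$ to isomorphisms, and every functor out of $\mathcal{C}_{cf}$ with that property factors uniquely (strictly) through $\gamma$; size issues are ignored. The homotopy relation $\sim_{\mathcal{W}}$ relates parallel arrows $f,g$ of $\mathcal{C}_{cf}$ if and only if $\gamma f=\gamma g$ in $Ho(\mathcal{C}_{cf})$. A congruence in a category is a choice of an equivalence relation on each hom-set such that $f\sim g$ implies $vfu\sim vgu$ whenever the compositions make sense; the quotient $\mathcal{C}_{cf}/{\sim}$ has the same objects and the classes of arrows as arrows. Uniqueness means: if $\sim$ is a congruence in $\mathcal{C}_{cf}$ such that $\gamma$ factors through the quotient functor $\mathcal{C}_{cf}\to\mathcal{C}_{cf}/{\sim}$ and the resulting induced functor $\mathcal{C}_{cf}/{\sim}\to Ho(\mathcal{C}_{cf})$ is an isomorphism of categories, then $\sim$ equals $\sim_{\mathcal{W}}$. *)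

theory Defs
  imports Main
begin

section \<open>Categories and functors\<close>

record ('o, 'm) cat =
  Obj :: "'o set"
  Arr :: "'m set"
  Dom :: "'m \<Rightarrow> 'o"
  Cod :: "'m \<Rightarrow> 'o"
  Ident :: "'o \<Rightarrow> 'm"
  Comp :: "'m \<Rightarrow> 'm \<Rightarrow> 'm"

text \<open>Composition is written in applicative order: \<open>Comp C g f\<close> is \<open>g\<close> after \<open>f\<close>.\<close>

definition Hom :: "('o, 'm) cat \<Rightarrow> 'o \<Rightarrow> 'o \<Rightarrow> 'm set" where
  "Hom C a b = {f \<in> Arr C. Dom C f = a \<and> Cod C f = b}"

locale category =
  fixes C :: "('o, 'm) cat"
  assumes Dom_Obj: "f \<in> Arr C \<Longrightarrow> Dom C f \<in> Obj C"
    and Cod_Obj: "f \<in> Arr C \<Longrightarrow> Cod C f \<in> Obj C"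
    and Ident_Hom: "a \<in> Obj C \<Longrightarrow> Ident C a \<in> Hom C a a"
    and Comp_Hom: "f \<in> Hom C a b \<Longrightarrow> g \<in> Hom C b c \<Longrightarrow> Comp C g f \<in> Hom C a c"
    and Comp_Ident_right: "f \<in> Hom C a b \<Longrightarrow> Comp C f (Ident C a) = f"
    and Comp_Ident_left: "f \<in> Hom C a b \<Longrightarrow> Comp C (Ident C b) f = f"
    and Comp_assoc: "f \<in> Hom C a b \<Longrightarrow> g \<in> Hom C b c \<Longrightarrow> h \<in> Hom C c d \<Longrightarrow>
      Comp C h (Comp C g f) = Comp C (Comp C h g) f"

definition opposite :: "('o, 'm) cat \<Rightarrow> ('o, 'm) cat" where
  "opposite C = \<lparr>Obj = Obj C, Arr = Arr C, Dom = Cod C, Cod = Dom C, Ident = Ident C,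
     Comp = (\<lambda>g f. Comp C f g)\<rparr>"

definition full_subcategory :: "('o, 'm) cat \<Rightarrow> 'o set \<Rightarrow> ('o, 'm) cat" where
  "full_subcategory C S = C\<lparr>Obj := Obj C \<inter> S,
     Arr := {f \<in> Arr C. Dom C f \<in> S \<and> Cod C f \<in> S}\<rparr>"

definition is_iso :: "('o, 'm) cat \<Rightarrow> 'm \<Rightarrow> bool" where
  "is_iso C f \<longleftrightarrow> f \<in> Arr C \<and> (\<exists>g \<in> Hom C (Cod C f) (Dom C f).
     Comp C g f = Ident C (Dom C f) \<and> Comp C f g = Ident C (Cod C f))"

record ('o, 'm, 'p, 'n) func =
  OMap :: "'o \<Rightarrow> 'p"
  AMap :: "'m \<Rightarrow> 'n"

definition is_functor :: "('o, 'm) cat \<Rightarrow> ('p, 'n) cat \<Rightarrow> ('o, 'm, 'p, 'n) func \<Rightarrow> bool" where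
  "is_functor A B F \<longleftrightarrow>
     (\<forall>a \<in> Obj A. OMap F a \<in> Obj B) \<and>
     (\<forall>f \<in> Arr A. AMap F f \<in> Hom B (OMap F (Dom A f)) (OMap F (Cod A f))) \<and>
     (\<forall>a \<in> Obj A. AMap F (Ident A a) = Ident B (OMap F a)) \<and>
     (\<forall>f \<in> Arr A. \<forall>g \<in> Arr A. Cod A f = Dom A g \<longrightarrow>
        AMap F (Comp A g f) = Comp B (AMap F g) (AMap F f))"

text \<open>Strict equality of functors with domain \<open>A\<close>; values outside \<open>A\<close> are irrelevant.\<close>

definition functor_eq ::
    "('o, 'm) cat \<Rightarrow> ('o, 'm, 'p, 'n) func \<Rightarrow> ('o, 'm, 'p, 'n) func \<Rightarrow> bool" where
  "functor_eq A F G \<longleftrightarrow>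
     (\<forall>a \<in> Obj A. OMap F a = OMap G a) \<and> (\<forall>f \<in> Arr A. AMap F f = AMap G f)"

definition functor_id :: "('o, 'm, 'o, 'm) func" where
  "functor_id = \<lparr>OMap = (\<lambda>a. a), AMap = (\<lambda>f. f)\<rparr>"

definition functor_comp ::
    "('p, 'n, 'q, 'k) func \<Rightarrow> ('o, 'm, 'p, 'n) func \<Rightarrow> ('o, 'm, 'q, 'k) func" where
  "functor_comp G F = \<lparr>OMap = OMap G \<circ> OMap F, AMap = AMap G \<circ> AMap F\<rparr>"

definition is_cat_isomorphism ::
    "('o, 'm) cat \<Rightarrow> ('p, 'n) cat \<Rightarrow> ('o, 'm, 'p, 'n) func \<Rightarrow> bool" where
  "is_cat_isomorphism A B F \<longleftrightarrow> is_functor A B F \<and>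
     (\<exists>G. is_functor B A G \<and> functor_eq A (functor_comp G F) functor_id \<and>
          functor_eq B (functor_comp F G) functor_id)"


section \<open>Finite limits and colimits\<close>

definition is_cone :: "('j, 'i) cat \<Rightarrow> ('o, 'm) cat \<Rightarrow> ('j, 'i, 'o, 'm) func \<Rightarrow>
    'o \<Rightarrow> ('j \<Rightarrow> 'm) \<Rightarrow> bool" where
  "is_cone J C F c l \<longleftrightarrow> c \<in> Obj C \<and> (\<forall>j \<in> Obj J. l j \<in> Hom C c (OMap F j)) \<and>
     (\<forall>u \<in> Arr J. Comp C (AMap F u) (l (Dom J u)) = l (Cod J u))"

definition is_limit_cone :: "('j, 'i) cat \<Rightarrow> ('o, 'm) cat \<Rightarrow> ('j, 'i, 'o, 'm) func \<Rightarrow>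
    'o \<Rightarrow> ('j \<Rightarrow> 'm) \<Rightarrow> bool" where
  "is_limit_cone J C F c l \<longleftrightarrow> is_cone J C F c l \<and>
     (\<forall>c' l'. is_cone J C F c' l' \<longrightarrow>
        (\<exists>!h. h \<in> Hom C c' c \<and> (\<forall>j \<in> Obj J. Comp C (l j) h = l' j)))"

text \<open>Every finite category is isomorphic to one whose objects and arrows are natural numbers.\<close>

definition has_finite_limits :: "('o, 'm) cat \<Rightarrow> bool" where
  "has_finite_limits C \<longleftrightarrow>
     (\<forall>(J :: (nat, nat) cat) F. category J \<and> finite (Obj J) \<and> finite (Arr J) \<and> is_functor J C F \<longrightarrow>
        (\<exists>c l. is_limit_cone J C F c l))"

definition has_finite_colimits :: "('o, 'm) cat \<Rightarrow> bool" where
  "has_finite_colimits C \<longleftrightarrow> has_finite_limits (opposite C)"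

definition is_initial :: "('o, 'm) cat \<Rightarrow> 'o \<Rightarrow> bool" where
  "is_initial C z \<longleftrightarrow> z \<in> Obj C \<and> (\<forall>x \<in> Obj C. \<exists>!f. f \<in> Hom C z x)"

definition is_terminal :: "('o, 'm) cat \<Rightarrow> 'o \<Rightarrow> bool" where
  "is_terminal C t \<longleftrightarrow> t \<in> Obj C \<and> (\<forall>x \<in> Obj C. \<exists>!f. f \<in> Hom C x t)"


section \<open>Model categories\<close>

text \<open>\<open>f\<close> is a retract of \<open>g\<close> in the category of arrows of \<open>C\<close>.\<close>

definition is_retract_of :: "('o, 'm) cat \<Rightarrow> 'm \<Rightarrow> 'm \<Rightarrow> bool" where
  "is_retract_of C f g \<longleftrightarrow> f \<in> Arr C \<and> g \<in> Arr C \<and>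
     (\<exists>i \<in> Hom C (Dom C f) (Dom C g). \<exists>r \<in> Hom C (Dom C g) (Dom C f).
      \<exists>j \<in> Hom C (Cod C f) (Cod C g). \<exists>s \<in> Hom C (Cod C g) (Cod C f).
        Comp C r i = Ident C (Dom C f) \<and> Comp C s j = Ident C (Cod C f) \<and>
        Comp C g i = Comp C j f \<and> Comp C f r = Comp C s g)"

definition has_lifting :: "('o, 'm) cat \<Rightarrow> 'm \<Rightarrow> 'm \<Rightarrow> bool" where
  "has_lifting C i p \<longleftrightarrow>
     (\<forall>u \<in> Hom C (Dom C i) (Dom C p). \<forall>v \<in> Hom C (Cod C i) (Cod C p).
        Comp C p u = Comp C v i \<longrightarrow>
        (\<exists>h \<in> Hom C (Cod C i) (Dom C p). Comp C h i = u \<and> Comp C p h = v))"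

text \<open>
  Quillen's axioms for a (closed) model category, with finite limits and colimits and with
  factorizations that are not required to be functorial.
\<close>

locale model_category = category C for C :: "('o, 'm) cat" +
  fixes We Fib Cof :: "'m set"
  assumes classes: "We \<subseteq> Arr C" "Fib \<subseteq> Arr C" "Cof \<subseteq> Arr C"
    and finite_limits: "has_finite_limits C"
    and finite_colimits: "has_finite_colimits C"
    and two_of_three:
      "f \<in> Hom C a b \<Longrightarrow> g \<in> Hom C b c \<Longrightarrow> f \<in> We \<Longrightarrow> g \<in> We \<Longrightarrow> Comp C g f \<in> We"
      "f \<in> Hom C a b \<Longrightarrow> g \<in> Hom C b c \<Longrightarrow> f \<in> We \<Longrightarrow> Comp C g f \<in> We \<Longrightarrow> g \<in> We"
      "f \<in> Hom C a b \<Longrightarrow> g \<in> Hom C b c \<Longrightarrow> g \<in> We \<Longrightarrow> Comp C g f \<in> We \<Longrightarrow> f \<in> We"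
    and retracts:
      "is_retract_of C f g \<Longrightarrow> g \<in> We \<Longrightarrow> f \<in> We"
      "is_retract_of C f g \<Longrightarrow> g \<in> Fib \<Longrightarrow> f \<in> Fib"
      "is_retract_of C f g \<Longrightarrow> g \<in> Cof \<Longrightarrow> f \<in> Cof"
    and lifting:
      "i \<in> Cof \<inter> We \<Longrightarrow> p \<in> Fib \<Longrightarrow> has_lifting C i p"
      "i \<in> Cof \<Longrightarrow> p \<in> Fib \<inter> We \<Longrightarrow> has_lifting C i p"
    and factorization:
      "f \<in> Hom C a b \<Longrightarrow>
         \<exists>c. \<exists>i \<in> Hom C a c. \<exists>p \<in> Hom C c b. i \<in> Cof \<inter> We \<and> p \<in> Fib \<and> Comp C p i = f"
      "f \<in> Hom C a b \<Longrightarrow>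
         \<exists>c. \<exists>i \<in> Hom C a c. \<exists>p \<in> Hom C c b. i \<in> Cof \<and> p \<in> Fib \<inter> We \<and> Comp C p i = f"

definition cofibrant :: "('o, 'm) cat \<Rightarrow> 'm set \<Rightarrow> 'o \<Rightarrow> bool" where
  "cofibrant C Cof x \<longleftrightarrow> x \<in> Obj C \<and> (\<exists>z. is_initial C z \<and> (\<exists>f \<in> Hom C z x. f \<in> Cof))"

definition fibrant :: "('o, 'm) cat \<Rightarrow> 'm set \<Rightarrow> 'o \<Rightarrow> bool" where
  "fibrant C Fib x \<longleftrightarrow> x \<in> Obj C \<and> (\<exists>t. is_terminal C t \<and> (\<exists>f \<in> Hom C x t. f \<in> Fib))"

definition cf_subcategory :: "('o, 'm) cat \<Rightarrow> 'm set \<Rightarrow> 'm set \<Rightarrow> ('o, 'm) cat" where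
  "cf_subcategory C Fib Cof = full_subcategory C {x. fibrant C Fib x \<and> cofibrant C Cof x}"

definition cf_weak_equivalences ::
    "('o, 'm) cat \<Rightarrow> 'm set \<Rightarrow> 'm set \<Rightarrow> 'm set \<Rightarrow> 'm set" where
  "cf_weak_equivalences C We Fib Cof = We \<inter> Arr (cf_subcategory C Fib Cof)"


section \<open>Localization\<close>

text \<open>
  \<open>\<gamma> : A \<rightarrow> H\<close> is the localization of \<open>A\<close> at \<open>W\<close>. A formula cannot quantify over types, so
  the types of the objects and arrows of the test categories \<open>D\<close> are the parameters
  \<open>'q\<close> and \<open>'k\<close>; a localization satisfies this for all choices of them. Assuming it only for some
  choices, such as the types of \<open>H\<close> and of the quotients of \<open>A\<close>, is a weaker hypothesis.
\<close>

definition is_localization :: "'q itself \<Rightarrow> 'k itself \<Rightarrow> ('o, 'm) cat \<Rightarrow> 'm set \<Rightarrow>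
    ('p, 'n) cat \<Rightarrow> ('o, 'm, 'p, 'n) func \<Rightarrow> bool" where
  "is_localization Q K A W H \<gamma> \<longleftrightarrow>
     category H \<and> is_functor A H \<gamma> \<and> (\<forall>w \<in> W. is_iso H (AMap \<gamma> w)) \<and>
     (\<forall>(D :: ('q, 'k) cat) F.
        category D \<and> is_functor A D F \<and> (\<forall>w \<in> W. is_iso D (AMap F w)) \<longrightarrow>
        (\<exists>G. is_functor H D G \<and> functor_eq A (functor_comp G \<gamma>) F \<and>
          (\<forall>G'. is_functor H D G' \<and> functor_eq A (functor_comp G' \<gamma>) F \<longrightarrow> functor_eq H G' G)))"


section \<open>Congruences and quotients\<close>

definition is_congruence :: "('o, 'm) cat \<Rightarrow> 'm rel \<Rightarrow> bool" where
  "is_congruence A R \<longleftrightarrow>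
     (\<forall>(f, g) \<in> R. f \<in> Arr A \<and> g \<in> Arr A \<and> Dom A f = Dom A g \<and> Cod A f = Cod A g) \<and>
     (\<forall>a \<in> Obj A. \<forall>b \<in> Obj A. equiv (Hom A a b) (R \<inter> Hom A a b \<times> Hom A a b)) \<and>
     (\<forall>(f, g) \<in> R. \<forall>u \<in> Arr A. \<forall>v \<in> Arr A. Cod A u = Dom A f \<and> Dom A v = Cod A f \<longrightarrow>
        (Comp A v (Comp A f u), Comp A v (Comp A g u)) \<in> R)"

definition quotient_category :: "('o, 'm) cat \<Rightarrow> 'm rel \<Rightarrow> ('o, 'm set) cat" where
  "quotient_category A R =
     \<lparr>Obj = Obj A,
      Arr = Arr A // R,
      Dom = (\<lambda>X. the_elem (Dom A ` X)),
      Cod = (\<lambda>X. the_elem (Cod A ` X)),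
      Ident = (\<lambda>a. R `` {Ident A a}),
      Comp = (\<lambda>Y X. \<Union>g \<in> Y. \<Union>f \<in> X. R `` {Comp A g f})\<rparr>"

definition quotient_functor :: "'m rel \<Rightarrow> ('o, 'm, 'o, 'm set) func" where
  "quotient_functor R = \<lparr>OMap = (\<lambda>a. a), AMap = (\<lambda>f. R `` {f})\<rparr>"

text \<open>
  \<open>\<gamma>\<close> factors through the quotient functor and the induced functor is an isomorphism. The
  induced functor is unique because the quotient functor is surjective on objects and arrows.
\<close>

definition induces_isomorphism ::
    "('o, 'm) cat \<Rightarrow> 'm rel \<Rightarrow> ('p, 'n) cat \<Rightarrow> ('o, 'm, 'p, 'n) func \<Rightarrow> bool" where
  "induces_isomorphism A R H \<gamma> \<longleftrightarrow>
     (\<exists>G. is_functor (quotient_category A R) H G \<and>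
          functor_eq A (functor_comp G (quotient_functor R)) \<gamma> \<and>
          is_cat_isomorphism (quotient_category A R) H G)"

definition homotopy_relation :: "('o, 'm) cat \<Rightarrow> ('o, 'm, 'p, 'n) func \<Rightarrow> 'm rel" where
  "homotopy_relation A \<gamma> = {(f, g). f \<in> Arr A \<and> g \<in> Arr A \<and>
     Dom A f = Dom A g \<and> Cod A f = Cod A g \<and> AMap \<gamma> f = AMap \<gamma> g}"


section \<open>Existence of localizations\<close>

text \<open>
  Classes of zigzags yield one category that is a localization with respect to test categories
  of all types. Letters \<open>Inl f\<close> stand for arrows of \<open>A\<close>, letters \<open>Inr w\<close> for
  formal inverses; zigzags are read from left to right.
\<close>

inductive zigzag :: "('o, 'm) cat \<Rightarrow> 'm set \<Rightarrow> 'o \<Rightarrow> ('m + 'm) list \<Rightarrow> 'o \<Rightarrow> bool"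
  for A W where
  nil: "a \<in> Obj A \<Longrightarrow> zigzag A W a [] a"
| fwd: "f \<in> Arr A \<Longrightarrow> zigzag A W (Cod A f) u b \<Longrightarrow> zigzag A W (Dom A f) (Inl f # u) b"
| bwd: "w \<in> W \<Longrightarrow> zigzag A W (Dom A w) u b \<Longrightarrow> zigzag A W (Cod A w) (Inr w # u) b"

inductive zigzag_eq ::
    "('o, 'm) cat \<Rightarrow> 'm set \<Rightarrow> 'o \<Rightarrow> 'o \<Rightarrow> ('m + 'm) list \<Rightarrow> ('m + 'm) list \<Rightarrow> bool"
  for A W where
  refl: "zigzag A W a u b \<Longrightarrow> zigzag_eq A W a b u u"
| sym: "zigzag_eq A W a b u v \<Longrightarrow> zigzag_eq A W a b v u"
| trans: "zigzag_eq A W a b u v \<Longrightarrow> zigzag_eq A W a b v w \<Longrightarrow> zigzag_eq A W a b u w"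
| app: "zigzag_eq A W a b u v \<Longrightarrow> zigzag_eq A W b c u' v' \<Longrightarrow>
    zigzag_eq A W a c (u @ u') (v @ v')"
| ident: "a \<in> Obj A \<Longrightarrow> zigzag_eq A W a a [Inl (Ident A a)] []"
| comp: "f \<in> Hom A a b \<Longrightarrow> g \<in> Hom A b c \<Longrightarrow>
    zigzag_eq A W a c [Inl f, Inl g] [Inl (Comp A g f)]"
| inv1: "w \<in> W \<Longrightarrow> zigzag_eq A W (Dom A w) (Dom A w) [Inl w, Inr w] []"
| inv2: "w \<in> W \<Longrightarrow> zigzag_eq A W (Cod A w) (Cod A w) [Inr w, Inl w] []"

definition zz_class ::
    "('o, 'm) cat \<Rightarrow> 'm set \<Rightarrow> 'o \<Rightarrow> ('m + 'm) list \<Rightarrow> 'o \<Rightarrow> 'o \<times> ('m + 'm) list set \<times> 'o" where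
  "zz_class A W a u b = (a, {v. zigzag_eq A W a b u v}, b)"

definition zz_localization ::
    "('o, 'm) cat \<Rightarrow> 'm set \<Rightarrow> ('o, 'o \<times> ('m + 'm) list set \<times> 'o) cat" where
  "zz_localization A W =
     \<lparr>Obj = Obj A,
      Arr = {zz_class A W a u b | a u b. zigzag A W a u b},
      Dom = fst,
      Cod = snd \<circ> snd,
      Ident = (\<lambda>a. zz_class A W a [] a),
      Comp = (\<lambda>(b, V, c) (a, U, b'). zz_class A W a ((SOME u. u \<in> U) @ (SOME v. v \<in> V)) c)\<rparr>"

definition zz_functor ::
    "('o, 'm) cat \<Rightarrow> 'm set \<Rightarrow> ('o, 'm, 'o, 'o \<times> ('m + 'm) list set \<times> 'o) func" where
  "zz_functor A W = \<lparr>OMap = (\<lambda>a. a), AMap = (\<lambda>f. zz_class A W (Dom A f) [Inl f] (Cod A f))\<rparr>"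

definition inv_arrow :: "('q, 'k) cat \<Rightarrow> 'k \<Rightarrow> 'k" where
  "inv_arrow D f = (SOME g. g \<in> Hom D (Cod D f) (Dom D f) \<and>
     Comp D g f = Ident D (Dom D f) \<and> Comp D f g = Ident D (Cod D f))"

fun zz_eval :: "('o, 'm) cat \<Rightarrow> ('q, 'k) cat \<Rightarrow> ('o, 'm, 'q, 'k) func \<Rightarrow>
    'o \<Rightarrow> ('m + 'm) list \<Rightarrow> 'k" where
  "zz_eval A D F a [] = Ident D (OMap F a)"
| "zz_eval A D F a (Inl f # u) = Comp D (zz_eval A D F (Cod A f) u) (AMap F f)"
| "zz_eval A D F a (Inr w # u) = Comp D (zz_eval A D F (Dom A w) u) (inv_arrow D (AMap F w))"

locale zz = category A for A :: "('o, 'm) cat" +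
  fixes W :: "'m set"
  assumes W: "W \<subseteq> Arr A"
begin

lemma zz_Obj: "zigzag A W a u b \<Longrightarrow> a \<in> Obj A \<and> b \<in> Obj A"
  by (induction rule: zigzag.induct) (use W in \<open>auto intro: Dom_Obj Cod_Obj\<close>)

lemma zz_append: "zigzag A W a u b \<Longrightarrow> zigzag A W b v c \<Longrightarrow> zigzag A W a (u @ v) c"
  by (induction rule: zigzag.induct) (auto intro: zigzag.intros)

lemma zz_fwd: "f \<in> Hom A a b \<Longrightarrow> zigzag A W b u c \<Longrightarrow> zigzag A W a (Inl f # u) c"
  using zigzag.fwd[of f A W u c] by (auto simp: Hom_def)

lemma zz_bwd: "w \<in> W \<Longrightarrow> a = Cod A w \<Longrightarrow> zigzag A W (Dom A w) u c \<Longrightarrow> zigzag A W a (Inr w # u) c"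
  using zigzag.bwd[of w W A u c] by auto

lemma zz_single: "f \<in> Hom A a b \<Longrightarrow> zigzag A W a [Inl f] b"
  by (rule zz_fwd) (auto simp: Hom_def intro: zigzag.nil Cod_Obj)

lemma zz_eq_zigzag: "zigzag_eq A W a b u v \<Longrightarrow> zigzag A W a u b \<and> zigzag A W a v b"
proof (induction rule: zigzag_eq.induct)
  case (ident a)
  then show ?case by (auto intro: zz_single Ident_Hom zigzag.nil)
next
  case (comp f a b g c)
  then show ?case by (auto intro: zz_single zz_fwd Comp_Hom)
next
  case (inv1 w)
  then have h: "w \<in> Hom A (Dom A w) (Cod A w)" "Dom A w \<in> Obj A"
    using W Dom_Obj by (auto simp: Hom_def)
  then show ?case using inv1 by (auto intro: zz_fwd zz_bwd zigzag.nil)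
next
  case (inv2 w)
  then have h: "w \<in> Hom A (Dom A w) (Cod A w)" "Cod A w \<in> Obj A"
    using W Cod_Obj by (auto simp: Hom_def)
  then show ?case using inv2 by (auto intro: zz_bwd zz_single zigzag.nil)
qed (auto intro: zz_append)

lemma zz_class_eq:
  assumes "zigzag_eq A W a b u v" shows "zz_class A W a u b = zz_class A W a v b"
  using assms by (auto simp: zz_class_def intro: zigzag_eq.sym zigzag_eq.trans)

lemma zz_some:
  assumes "zigzag A W a u b"
  shows "zigzag_eq A W a b u (SOME v. v \<in> {v. zigzag_eq A W a b u v})"
  using someI[of "\<lambda>v. zigzag_eq A W a b u v" u] zigzag_eq.refl[OF assms] by simp

abbreviation "L \<equiv> zz_localization A W"
abbreviation "cls \<equiv> zz_class A W"

lemma L_Hom: "X \<in> Hom L a b \<longleftrightarrow> (\<exists>u. zigzag A W a u b \<and> X = cls a u b)"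
  by (auto simp: Hom_def zz_localization_def zz_class_def)

lemma L_Dom [simp]: "Dom L (cls a u b) = a" and L_Cod [simp]: "Cod L (cls a u b) = b"
  by (auto simp: zz_localization_def zz_class_def)

lemma L_Obj [simp]: "Obj L = Obj A" and L_Ident [simp]: "Ident L a = cls a [] a"
  by (auto simp: zz_localization_def)

lemma L_Comp:
  assumes "zigzag A W a u b" "zigzag A W b v c"
  shows "Comp L (cls b v c) (cls a u b) = cls a (u @ v) c"
  using zz_class_eq[OF zigzag_eq.app[OF zz_some[OF assms(1)] zz_some[OF assms(2)]]]
  by (simp add: zz_localization_def zz_class_def)

lemma L_category: "category L"
proof
  show "Dom L f \<in> Obj L" "Cod L f \<in> Obj L" if "f \<in> Arr L" for f
    using that zz_Obj by (auto simp: zz_localization_def zz_class_def)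
  show "Ident L a \<in> Hom L a a" if "a \<in> Obj L" for a
    using that by (auto simp: L_Hom intro: zigzag.nil)
  show "Comp L g f \<in> Hom L a c" if "f \<in> Hom L a b" "g \<in> Hom L b c" for f g a b c
    using that by (metis L_Hom L_Comp zz_append)
  show "Comp L f (Ident L a) = f" "Comp L (Ident L b) f = f" if f: "f \<in> Hom L a b" for f a b
  proof -
    obtain u where u: "zigzag A W a u b" "f = cls a u b" using f L_Hom by blast
    have n: "zigzag A W a [] a" "zigzag A W b [] b" using zz_Obj[OF u(1)] by (auto intro: zigzag.nil)
    show "Comp L f (Ident L a) = f" "Comp L (Ident L b) f = f"
      using L_Comp[OF n(1) u(1)] L_Comp[OF u(1) n(2)] u(2) by simp_all
  qed
  show "Comp L h (Comp L g f) = Comp L (Comp L h g) f"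
    if fgh: "f \<in> Hom L a b" "g \<in> Hom L b c" "h \<in> Hom L c d" for f g h a b c d
  proof -
    obtain u v w where "zigzag A W a u b" "f = cls a u b" "zigzag A W b v c" "g = cls b v c"
      "zigzag A W c w d" "h = cls c w d" using fgh L_Hom by metis
    then show ?thesis by (simp add: L_Comp zz_append)
  qed
qed

lemma L_functor: "is_functor A L (zz_functor A W)"
  unfolding is_functor_def
proof (intro conjI ballI impI)
  show "AMap (zz_functor A W) (Ident A a) = Ident L (OMap (zz_functor A W) a)"
    if "a \<in> Obj A" for a
    using zz_class_eq[OF zigzag_eq.ident[OF that, where W = W]] Ident_Hom[OF that]
    by (simp add: zz_functor_def Hom_def)
  show "AMap (zz_functor A W) f \<in> Hom L (OMap (zz_functor A W) (Dom A f)) (OMap (zz_functor A W) (Cod A f))"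
    if "f \<in> Arr A" for f
    using zz_single[of f "Dom A f" "Cod A f"] that
    by (auto simp: zz_functor_def L_Hom) (auto simp: Hom_def)
  show "AMap (zz_functor A W) (Comp A g f) = Comp L (AMap (zz_functor A W) g) (AMap (zz_functor A W) f)"
    if "f \<in> Arr A" "g \<in> Arr A" "Cod A f = Dom A g" for f g
  proof -
    have f: "f \<in> Hom A (Dom A f) (Dom A g)" and g: "g \<in> Hom A (Dom A g) (Cod A g)"
      using that by (auto simp: Hom_def)
    have "Comp A g f \<in> Hom A (Dom A f) (Cod A g)" by (rule Comp_Hom[OF f g])
    then show ?thesis
      using L_Comp[OF zz_single[OF f] zz_single[OF g]]
        zz_class_eq[OF zigzag_eq.comp[OF f g, where W = W]] that(3)
      by (simp add: zz_functor_def Hom_def)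
  qed
qed (simp add: zz_functor_def)

lemma L_inverse:
  assumes w: "w \<in> W"
  defines "v \<equiv> cls (Cod A w) [Inr w] (Dom A w)"
  shows "v \<in> Hom L (Cod A w) (Dom A w)"
    "Comp L v (AMap (zz_functor A W) w) = Ident L (Dom A w)"
    "Comp L (AMap (zz_functor A W) w) v = Ident L (Cod A w)"
proof -
  have h: "w \<in> Hom A (Dom A w) (Cod A w)" "Dom A w \<in> Obj A"
    using w W Dom_Obj by (auto simp: Hom_def)
  have z: "zigzag A W (Cod A w) [Inr w] (Dom A w)"
    using w h by (auto intro: zz_bwd zigzag.nil)
  show "v \<in> Hom L (Cod A w) (Dom A w)" using z unfolding v_def L_Hom by blast
  show "Comp L v (AMap (zz_functor A W) w) = Ident L (Dom A w)"
    using L_Comp[OF zz_single[OF h(1)] z] zz_class_eq[OF zigzag_eq.inv1[OF w, of A]]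
    by (simp add: v_def zz_functor_def)
  show "Comp L (AMap (zz_functor A W) w) v = Ident L (Cod A w)"
    using L_Comp[OF z zz_single[OF h(1)]] zz_class_eq[OF zigzag_eq.inv2[OF w, of A]]
    by (simp add: v_def zz_functor_def)
qed

lemma L_iso: "w \<in> W \<Longrightarrow> is_iso L (AMap (zz_functor A W) w)"
proof -
  assume w: "w \<in> W"
  then have "AMap (zz_functor A W) w \<in> Hom L (Dom A w) (Cod A w)"
    using L_functor W by (auto simp: is_functor_def zz_functor_def)
  then have "AMap (zz_functor A W) w \<in> Arr L" "Dom L (AMap (zz_functor A W) w) = Dom A w"
    "Cod L (AMap (zz_functor A W) w) = Cod A w" by (auto simp: Hom_def)
  then show ?thesis using L_inverse[OF w] unfolding is_iso_def by metis
qed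

end

lemma (in category) inverse_unique:
  assumes "f \<in> Hom C a b" "g \<in> Hom C b a" "h \<in> Hom C b a"
    "Comp C g f = Ident C a" "Comp C f h = Ident C b"
  shows "g = h"
  using Comp_assoc[OF assms(3,1,2)] Comp_Ident_right[OF assms(2)] Comp_Ident_left[OF assms(3)] assms(4,5)
  by simp

lemma inv_arrow:
  assumes "is_iso D f" "f \<in> Hom D a b"
  shows "inv_arrow D f \<in> Hom D b a" "Comp D (inv_arrow D f) f = Ident D a"
    "Comp D f (inv_arrow D f) = Ident D b"
proof -
  have "inv_arrow D f \<in> Hom D (Cod D f) (Dom D f) \<and>
     Comp D (inv_arrow D f) f = Ident D (Dom D f) \<and> Comp D f (inv_arrow D f) = Ident D (Cod D f)"
    unfolding inv_arrow_def by (rule someI_ex) (use assms(1) in \<open>auto simp: is_iso_def\<close>)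
  then show "inv_arrow D f \<in> Hom D b a" "Comp D (inv_arrow D f) f = Ident D a"
    "Comp D f (inv_arrow D f) = Ident D b" using assms(2) by (auto simp: Hom_def)
qed

locale zz_test = zz A W + D: category D
  for A :: "('o, 'm) cat" and W and D :: "('q, 'k) cat" +
  fixes F :: "('o, 'm, 'q, 'k) func"
  assumes F: "is_functor A D F" and iso: "w \<in> W \<Longrightarrow> is_iso D (AMap F w)"
begin

abbreviation "ev \<equiv> zz_eval A D F"

lemma F_Hom: "f \<in> Hom A a b \<Longrightarrow> AMap F f \<in> Hom D (OMap F a) (OMap F b)"
  using F by (auto simp: is_functor_def Hom_def)

lemma F_W: "w \<in> W \<Longrightarrow> AMap F w \<in> Hom D (OMap F (Dom A w)) (OMap F (Cod A w))"
  using F_Hom W by (auto simp: Hom_def)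

lemmas F_inv = inv_arrow[OF iso F_W]

lemma F_Obj: "a \<in> Obj A \<Longrightarrow> OMap F a \<in> Obj D"
  using F by (auto simp: is_functor_def)

lemma ev_Hom: "zigzag A W a u b \<Longrightarrow> ev a u \<in> Hom D (OMap F a) (OMap F b)"
proof (induction rule: zigzag.induct)
  case (nil a)
  then show ?case using D.Ident_Hom F_Obj by simp
next
  case (fwd f u b)
  then show ?case using D.Comp_Hom[OF F_Hom[of f]] by (simp add: Hom_def)
next
  case (bwd w u b)
  then show ?case using D.Comp_Hom[OF F_inv(1)] by simp
qed

lemma ev_append:
  "zigzag A W a u b \<Longrightarrow> zigzag A W b v c \<Longrightarrow> ev a (u @ v) = Comp D (ev b v) (ev a u)"
proof (induction rule: zigzag.induct)
  case (nil a)
  then show ?case using D.Comp_Ident_right[OF ev_Hom] by simp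
next
  case (fwd f u b)
  have "AMap F f \<in> Hom D (OMap F (Dom A f)) (OMap F (Cod A f))"
    using F_Hom fwd(1) by (auto simp: Hom_def)
  then show ?case using D.Comp_assoc[OF _ ev_Hom ev_Hom] fwd by simp
next
  case (bwd w u b)
  then show ?case using D.Comp_assoc[OF F_inv(1) ev_Hom ev_Hom] by simp
qed

lemma ev_single: "f \<in> Hom A a b \<Longrightarrow> ev a [Inl f] = AMap F f"
  using D.Comp_Ident_left[OF F_Hom] by (auto simp: Hom_def)

lemma ev_eq: "zigzag_eq A W a b u v \<Longrightarrow> ev a u = ev a v"
proof (induction rule: zigzag_eq.induct)
  case (app a b u v c u' v')
  then show ?case using zz_eq_zigzag ev_append by metis
next
  case (ident a)
  then show ?case using ev_single[OF Ident_Hom] F by (simp add: is_functor_def)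
next
  case (comp f a b g c)
  have "ev a ([Inl f] @ [Inl g]) = Comp D (ev b [Inl g]) (ev a [Inl f])"
    using comp zz_single by (intro ev_append)
  also have "\<dots> = Comp D (AMap F g) (AMap F f)"
    by (simp only: ev_single[OF comp(1)] ev_single[OF comp(2)])
  also have "\<dots> = AMap F (Comp A g f)"
    using comp F by (auto simp: is_functor_def Hom_def)
  also have "\<dots> = ev a [Inl (Comp A g f)]"
    by (simp only: ev_single[OF Comp_Hom[OF comp]])
  finally show ?case by simp
next
  case (inv1 w)
  then show ?case using D.Comp_Ident_left[OF F_inv(1)] F_inv(2) by simp
next
  case (inv2 w)
  then show ?case using D.Comp_Ident_left[OF F_W] F_inv(3) by simp
qed auto

definition G :: "('o, 'o \<times> ('m + 'm) list set \<times> 'o, 'q, 'k) func" where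
  "G = \<lparr>OMap = OMap F, AMap = (\<lambda>(a, U, b). ev a (SOME u. u \<in> U))\<rparr>"

lemma G_cls: "zigzag A W a u b \<Longrightarrow> AMap G (cls a u b) = ev a u"
  using ev_eq[OF zz_some] by (simp add: G_def zz_class_def)

lemma G_functor: "is_functor L D G"
  unfolding is_functor_def
proof (intro conjI ballI impI)
  show "AMap G f \<in> Hom D (OMap G (Dom L f)) (OMap G (Cod L f))" if "f \<in> Arr L" for f
  proof -
    have "f \<in> Hom L (Dom L f) (Cod L f)" using that by (simp add: Hom_def)
    then obtain u where u: "zigzag A W (Dom L f) u (Cod L f)" "f = cls (Dom L f) u (Cod L f)"
      using L_Hom by blast
    show ?thesis using ev_Hom[OF u(1)] G_cls[OF u(1)] u(2) by (simp add: G_def)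
  qed
  show "AMap G (Comp L g f) = Comp D (AMap G g) (AMap G f)"
    if "f \<in> Arr L" "g \<in> Arr L" "Cod L f = Dom L g" for f g
  proof -
    have "f \<in> Hom L (Dom L f) (Dom L g)" "g \<in> Hom L (Dom L g) (Cod L g)"
      using that by (auto simp: Hom_def)
    then obtain u v where u: "zigzag A W (Dom L f) u (Dom L g)" "f = cls (Dom L f) u (Dom L g)"
      and v: "zigzag A W (Dom L g) v (Cod L g)" "g = cls (Dom L g) v (Cod L g)"
      using L_Hom by meson
    have "AMap G (Comp L g f) = ev (Dom L f) (u @ v)"
      using L_Comp[OF u(1) v(1)] G_cls[OF zz_append[OF u(1) v(1)]] u(2) v(2) by simp
    then show ?thesis using ev_append[OF u(1) v(1)] G_cls[OF u(1)] G_cls[OF v(1)] u(2) v(2) by simp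
  qed
  show "AMap G (Ident L a) = Ident D (OMap G a)" if "a \<in> Obj L" for a
    using that G_cls[OF zigzag.nil, of a] by (simp add: G_def)
qed (simp add: G_def F_Obj)

lemma G_eq: "functor_eq A (functor_comp G (zz_functor A W)) F"
proof -
  have "AMap G (cls (Dom A f) [Inl f] (Cod A f)) = AMap F f" if "f \<in> Arr A" for f
    using that ev_single[of f] G_cls[OF zz_single, of f] by (auto simp: Hom_def)
  then show ?thesis by (auto simp: functor_eq_def functor_comp_def zz_functor_def G_def)
qed

lemma G_unique:
  assumes G': "is_functor L D G'" and eq: "functor_eq A (functor_comp G' (zz_functor A W)) F"
  shows "functor_eq L G' G"
proof -
  have O: "OMap G' a = OMap F a" if "a \<in> Obj A" for a
    using eq that by (auto simp: functor_eq_def functor_comp_def zz_functor_def)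
  have single: "AMap G' (cls (Dom A f) [Inl f] (Cod A f)) = AMap F f" if "f \<in> Arr A" for f
    using eq that by (auto simp: functor_eq_def functor_comp_def zz_functor_def)
  have G'_Hom: "AMap G' X \<in> Hom D (OMap G' a) (OMap G' b)" if "X \<in> Hom L a b" for X a b
    using G' that by (auto simp: is_functor_def Hom_def)
  have G'_Comp: "AMap G' (Comp L Y X) = Comp D (AMap G' Y) (AMap G' X)"
    if "X \<in> Hom L a b" "Y \<in> Hom L b c" for X Y a b c
    using G' that by (auto simp: is_functor_def Hom_def)
  have G'_Ident: "AMap G' (cls a [] a) = Ident D (OMap F a)" if "a \<in> Obj A" for a
    using G' that O by (auto simp: is_functor_def)
  have inv: "AMap G' (cls (Cod A w) [Inr w] (Dom A w)) = inv_arrow D (AMap F w)" if w: "w \<in> W" for w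
  proof -
    let ?v = "cls (Cod A w) [Inr w] (Dom A w)"
    have wA: "w \<in> Arr A" "Dom A w \<in> Obj A" "Cod A w \<in> Obj A" using w W Dom_Obj Cod_Obj by auto
    have h: "AMap (zz_functor A W) w \<in> Hom L (Dom A w) (Cod A w)"
      using L_functor wA by (auto simp: is_functor_def zz_functor_def)
    have "Comp D (AMap G' ?v) (AMap F w) = Ident D (OMap F (Dom A w))"
      using G'_Comp[OF h L_inverse(1)[OF w]] L_inverse(2)[OF w] G'_Ident single wA
      by (simp add: zz_functor_def)
    then show ?thesis
      using D.inverse_unique[OF F_W[OF w] _ F_inv(1)[OF w w] _ F_inv(3)[OF w w]]
        G'_Hom[OF L_inverse(1)[OF w]] O wA by simp
  qed
  have "AMap G' (cls a u b) = ev a u" if "zigzag A W a u b" for a u b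
    using that
  proof (induction rule: zigzag.induct)
    case (nil a)
    then show ?case using G'_Ident by simp
  next
    case (fwd f u b)
    have f: "zigzag A W (Dom A f) [Inl f] (Cod A f)" using fwd(1) zz_single by (auto simp: Hom_def)
    then have "AMap G' (cls (Dom A f) ([Inl f] @ u) b) =
        Comp D (AMap G' (cls (Cod A f) u b)) (AMap G' (cls (Dom A f) [Inl f] (Cod A f)))"
      using G'_Comp L_Hom fwd(2) L_Comp by metis
    then show ?case using fwd single by simp
  next
    case (bwd w u b)
    have w: "zigzag A W (Cod A w) [Inr w] (Dom A w)"
      using bwd(1) zz_Obj[OF bwd(2)] by (auto intro: zz_bwd zigzag.nil)
    then have "AMap G' (cls (Cod A w) ([Inr w] @ u) b) =
        Comp D (AMap G' (cls (Dom A w) u b)) (AMap G' (cls (Cod A w) [Inr w] (Dom A w)))"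
      using G'_Comp L_Hom bwd(2) L_Comp by metis
    then show ?case using bwd inv by simp
  qed
  then have "AMap G' f = AMap G f" if "f \<in> Arr L" for f
    using that G_cls by (auto simp: zz_localization_def)
  then show ?thesis using O by (auto simp: functor_eq_def G_def)
qed

end

theorem localization_exists:
  fixes Q :: "'q itself" and K :: "'k itself"
  assumes "category A" "W \<subseteq> Arr A"
  shows "is_localization Q K A W (zz_localization A W) (zz_functor A W)"
proof -
  interpret zz A W using assms by (simp add: zz_def zz_axioms_def)
  show ?thesis
    unfolding is_localization_def
  proof (intro conjI allI impI ballI)
    fix D :: "('q, 'k) cat" and F
    assume *: "category D \<and> is_functor A D F \<and> (\<forall>w \<in> W. is_iso D (AMap F w))"
    interpret zz_test A W D F
      using * zz_axioms by (auto simp: zz_test_def zz_test_axioms_def)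
    show "\<exists>G. is_functor L D G \<and> functor_eq A (functor_comp G (zz_functor A W)) F \<and>
      (\<forall>G'. is_functor L D G' \<and> functor_eq A (functor_comp G' (zz_functor A W)) F \<longrightarrow> functor_eq L G' G)"
      using G_functor G_eq G_unique by blast
  qed (simp_all add: L_category L_functor L_iso)
qed

end

theory Submission
  imports Defs
begin

text \<open>
  Write \<open>A\<close> for the category of fibrant-cofibrant objects, \<open>\<sim>\<close> for the relation
  \<open>\<gamma> f = \<gamma> g\<close> on parallel arrows, and \<open>q : A \<rightarrow> A/\<sim>\<close> for the quotient functor. The proof
  shows that \<open>q\<close> is itself a localization of \<open>A\<close>; no cylinder or path objects occur, because the
  relation is defined by \<open>\<gamma>\<close> from the outset.

  The only input from model categories is that \<open>q\<close> inverts weak equivalences, and for this it is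
  enough that the inverse of \<open>\<gamma> w\<close> in \<open>H\<close> is the image of an arrow of \<open>A\<close>. Factor
  \<open>w : a \<rightarrow> b\<close> as a trivial cofibration \<open>i\<close> followed by a fibration \<open>p\<close>, which is trivial by
  two-out-of-three. The middle object is again fibrant and cofibrant. Since \<open>a\<close> is fibrant, \<open>i\<close>
  has a retraction \<open>r\<close>; since \<open>b\<close> is cofibrant, \<open>p\<close> has a section \<open>s\<close>
  (\<open>cf_weak_equivalence_factorization\<close>). A one-sided inverse of an isomorphism is its inverse, so
  \<open>\<gamma> (r s)\<close> is inverse to \<open>\<gamma> w\<close> (\<open>iso_section_retraction_inverse\<close>).

  The rest is formal (\<open>localization_is_quotient\<close>). The universal property of \<open>\<gamma>\<close> yields
  \<open>G : H \<rightarrow> A/\<sim>\<close> with \<open>G \<gamma> = q\<close>, and by definition of \<open>\<sim>\<close> the functor \<open>\<gamma>\<close> factors as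
  \<open>K q\<close>. Then \<open>G K q = q\<close> gives \<open>G K = id\<close>, because \<open>q\<close> is surjective on objects and arrows, and
  \<open>K G \<gamma> = \<gamma>\<close> gives \<open>K G = id\<close> by the uniqueness part of the universal property.

  Conversely, if a congruence induces an isomorphism onto \<open>H\<close>, injectivity of the isomorphism on
  arrows forces two parallel arrows to be congruent exactly when \<open>\<gamma>\<close> identifies them
  (\<open>congruence_unique\<close>).
\<close>

section \<open>Quotient categories\<close>

locale category_congruence = category A for A :: "('o, 'm) cat" +
  fixes R :: "'m rel"
  assumes congruence: "is_congruence A R"
begin

lemma related_parallel:
  assumes "(f, g) \<in> R"
  shows "f \<in> Arr A" "g \<in> Arr A" "Dom A g = Dom A f" "Cod A g = Cod A f"
  using congruence assms by (auto simp: is_congruence_def)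

lemma equiv_on_Hom:
  "a \<in> Obj A \<Longrightarrow> b \<in> Obj A \<Longrightarrow> equiv (Hom A a b) (R \<inter> Hom A a b \<times> Hom A a b)"
  using congruence by (auto simp: is_congruence_def)

text \<open>
  A congruence is an equivalence relation on each hom-set separately. As related arrows are parallel
  and the hom-sets partition the arrows, it is one equivalence relation on all arrows, so that the
  general theory of quotient sets applies to the arrows of the quotient category.
\<close>

lemma equiv_on_Arr: "equiv (Arr A) R"
proof (rule equivI)
  have hom: "equiv (Hom A (Dom A f) (Cod A f))
      (R \<inter> Hom A (Dom A f) (Cod A f) \<times> Hom A (Dom A f) (Cod A f))" if "f \<in> Arr A" for f
    using that by (intro equiv_on_Hom Dom_Obj Cod_Obj)
  show "R \<subseteq> Arr A \<times> Arr A"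
    using related_parallel by auto
  show "refl_on (Arr A) R"
  proof (rule refl_onI)
    show "(f, f) \<in> R" if "f \<in> Arr A" for f
      using hom[OF that] that by (auto simp: equiv_def refl_on_def Hom_def)
  qed
  show "sym R"
  proof (rule symI)
    show "(g, f) \<in> R" if fg: "(f, g) \<in> R" for f g
      using hom[OF related_parallel(1)[OF fg]] related_parallel[OF fg] fg
      by (auto simp: equiv_def sym_def Hom_def)
  qed
  show "trans R"
  proof (rule transI)
    show "(f, h) \<in> R" if fg: "(f, g) \<in> R" and gh: "(g, h) \<in> R" for f g h
    proof -
      let ?X = "Hom A (Dom A f) (Cod A f)"
      have "(f, g) \<in> R \<inter> ?X \<times> ?X" "(g, h) \<in> R \<inter> ?X \<times> ?X"
        using related_parallel[OF fg] related_parallel[OF gh] fg gh by (auto simp: Hom_def)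
      then have "(f, h) \<in> R \<inter> ?X \<times> ?X"
        using hom[OF related_parallel(1)[OF fg]] by (meson equivE transE)
      then show ?thesis by simp
    qed
  qed
qed

lemma class_eq_iff: "f \<in> Arr A \<Longrightarrow> g \<in> Arr A \<Longrightarrow> R `` {f} = R `` {g} \<longleftrightarrow> (f, g) \<in> R"
  by (rule eq_equiv_class_iff[OF equiv_on_Arr])

lemma self_related: "f \<in> Arr A \<Longrightarrow> (f, f) \<in> R"
  using equiv_on_Arr by (auto simp: equiv_def refl_on_def)

text \<open>
  Whiskering changes one factor at a time: \<open>g f \<sim> g f' \<sim> g' f'\<close>. An identity fills the other
  side of the two-sided condition in the definition of a congruence.
\<close>

lemma comp_related:
  assumes "(f, f') \<in> R" "(g, g') \<in> R" "Cod A f = Dom A g"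
  shows "(Comp A g f, Comp A g' f') \<in> R"
proof -
  have f: "f \<in> Hom A (Dom A f) (Dom A g)" "f' \<in> Hom A (Dom A f) (Dom A g)"
    and g: "g \<in> Hom A (Dom A g) (Cod A g)" "g' \<in> Hom A (Dom A g) (Cod A g)"
    using related_parallel[OF assms(1)] related_parallel[OF assms(2)] assms(3)
    by (auto simp: Hom_def)
  have cong: "(Comp A v (Comp A x u), Comp A v (Comp A y u)) \<in> R"
    if "(x, y) \<in> R" "u \<in> Arr A" "v \<in> Arr A" "Cod A u = Dom A x" "Dom A v = Cod A x" for x y u v
    using congruence that unfolding is_congruence_def by blast
  have id: "Ident A a \<in> Arr A \<and> Dom A (Ident A a) = a \<and> Cod A (Ident A a) = a"
    if "a \<in> Obj A" for a using Ident_Hom[OF that] by (simp add: Hom_def)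
  have "(Comp A g (Comp A f (Ident A (Dom A f))), Comp A g (Comp A f' (Ident A (Dom A f)))) \<in> R"
    using cong[OF assms(1), of "Ident A (Dom A f)" g] f(1) g(1) id[OF Dom_Obj[of f]]
    by (simp add: Hom_def)
  moreover have "(Comp A (Ident A (Cod A g)) (Comp A g f'), Comp A (Ident A (Cod A g)) (Comp A g' f')) \<in> R"
    using cong[OF assms(2), of f' "Ident A (Cod A g)"] f(2) g(1) id[OF Cod_Obj[of g]]
    by (simp add: Hom_def)
  ultimately show ?thesis
    using Comp_Ident_right[OF f(1)] Comp_Ident_right[OF f(2)]
      Comp_Ident_left[OF Comp_Hom[OF f(2) g(1)]] Comp_Ident_left[OF Comp_Hom[OF f(2) g(2)]]
      equiv_on_Arr by (metis equivE transE)
qed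

abbreviation "Q \<equiv> quotient_category A R"
abbreviation "q \<equiv> quotient_functor R"

lemma q_simps [simp]: "OMap q a = a" "AMap q f = R `` {f}"
  by (simp_all add: quotient_functor_def)

lemma Q_Obj [simp]: "Obj Q = Obj A" and Q_Ident [simp]: "Ident Q a = R `` {Ident A a}"
  by (simp_all add: quotient_category_def)

lemma Q_Arr: "X \<in> Arr Q \<longleftrightarrow> (\<exists>f \<in> Arr A. X = R `` {f})"
  unfolding quotient_category_def cat.simps by (blast elim: quotientE intro: quotientI)

lemma Q_Dom_Cod [simp]:
  assumes "f \<in> Arr A"
  shows "Dom Q (R `` {f}) = Dom A f" "Cod Q (R `` {f}) = Cod A f"
proof -
  have f: "f \<in> R `` {f}" using self_related[OF assms] by simp
  have "Dom A ` (R `` {f}) = (\<lambda>_. Dom A f) ` (R `` {f})"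
    "Cod A ` (R `` {f}) = (\<lambda>_. Cod A f) ` (R `` {f})"
    by (rule image_cong; simp add: related_parallel)+
  then have "Dom A ` (R `` {f}) = {Dom A f}" "Cod A ` (R `` {f}) = {Cod A f}"
    unfolding image_constant[OF f] .
  then show "Dom Q (R `` {f}) = Dom A f" "Cod Q (R `` {f}) = Cod A f"
    by (simp_all add: quotient_category_def)
qed

lemma Q_Hom: "X \<in> Hom Q a b \<longleftrightarrow> (\<exists>f \<in> Hom A a b. X = R `` {f})"
proof
  assume "X \<in> Hom Q a b"
  then have X: "X \<in> Arr Q" "Dom Q X = a" "Cod Q X = b" by (simp_all add: Hom_def)
  then obtain f where "f \<in> Arr A" "X = R `` {f}" using Q_Arr by blast
  then show "\<exists>f \<in> Hom A a b. X = R `` {f}"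
    using X by (intro bexI[of _ f]) (simp_all add: Hom_def)
next
  assume "\<exists>f \<in> Hom A a b. X = R `` {f}"
  then obtain f where f: "f \<in> Arr A" "Dom A f = a" "Cod A f = b" "X = R `` {f}"
    by (auto simp: Hom_def)
  then have "X \<in> Arr Q" using Q_Arr by blast
  then show "X \<in> Hom Q a b" using f by (simp add: Hom_def)
qed

lemma Q_Comp:
  assumes "f \<in> Hom A a b" "g \<in> Hom A b c"
  shows "Comp Q (R `` {g}) (R `` {f}) = R `` {Comp A g f}"
proof -
  have f: "f \<in> Arr A" and g: "g \<in> Arr A" and fg: "Cod A f = Dom A g"
    using assms by (auto simp: Hom_def)
  have classes_eq: "R `` {Comp A g' f'} = R `` {Comp A g f}"
    if "g' \<in> R `` {g}" "f' \<in> R `` {f}" for f' g'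
    using equiv_class_eq[OF equiv_on_Arr comp_related[OF _ _ fg], of f' g'] that by simp
  have mem: "f \<in> R `` {f}" "g \<in> R `` {g}"
    using self_related[OF f] self_related[OF g] by simp_all
  have "(\<Union>g' \<in> R `` {g}. \<Union>f' \<in> R `` {f}. R `` {Comp A g' f'}) = R `` {Comp A g f}"
  proof (rule UN_constant_eq[OF mem(2)], rule ballI)
    show "(\<Union>f' \<in> R `` {f}. R `` {Comp A g' f'}) = R `` {Comp A g f}" if "g' \<in> R `` {g}" for g'
      by (rule UN_constant_eq[OF mem(1)], rule ballI) (rule classes_eq[OF that])
  qed
  then show ?thesis by (simp add: quotient_category_def)
qed

lemma Q_category: "category Q"
proof
  show "Dom Q X \<in> Obj Q" "Cod Q X \<in> Obj Q" if "X \<in> Arr Q" for X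
    using that Dom_Obj Cod_Obj by (auto simp: Q_Arr)
  show "Ident Q a \<in> Hom Q a a" if "a \<in> Obj Q" for a
    using that Ident_Hom by (auto simp: Q_Hom)
  show "Comp Q Y X \<in> Hom Q a c" if "X \<in> Hom Q a b" "Y \<in> Hom Q b c" for X Y a b c
    using that Comp_Hom Q_Comp by (fastforce simp: Q_Hom)
  show "Comp Q X (Ident Q a) = X" "Comp Q (Ident Q b) X = X" if X: "X \<in> Hom Q a b" for X a b
  proof -
    obtain f where f: "f \<in> Hom A a b" "X = R `` {f}" using X Q_Hom by blast
    then have "Ident A a \<in> Hom A a a" "Ident A b \<in> Hom A b b"
      using Ident_Hom Dom_Obj Cod_Obj by (auto simp: Hom_def)
    then show "Comp Q X (Ident Q a) = X" "Comp Q (Ident Q b) X = X"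
      using f Q_Comp Comp_Ident_left Comp_Ident_right by auto
  qed
  show "Comp Q Z (Comp Q Y X) = Comp Q (Comp Q Z Y) X"
    if XYZ: "X \<in> Hom Q a b" "Y \<in> Hom Q b c" "Z \<in> Hom Q c d" for X Y Z a b c d
  proof -
    obtain f g h where f: "f \<in> Hom A a b" "X = R `` {f}" and g: "g \<in> Hom A b c" "Y = R `` {g}"
      and h: "h \<in> Hom A c d" "Z = R `` {h}" using XYZ Q_Hom by metis
    then show ?thesis
      by (simp add: Q_Comp[OF f(1) g(1)] Q_Comp[OF g(1) h(1)] Q_Comp[OF Comp_Hom[OF f(1) g(1)] h(1)]
          Q_Comp[OF f(1) Comp_Hom[OF g(1) h(1)]] Comp_assoc[OF f(1) g(1) h(1)])
  qed
qed

lemma q_functor: "is_functor A Q q"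
  unfolding is_functor_def
proof (intro conjI ballI impI)
  show "AMap q f \<in> Hom Q (OMap q (Dom A f)) (OMap q (Cod A f))" if "f \<in> Arr A" for f
    using that unfolding Q_Hom q_simps by (auto simp: Hom_def)
  show "AMap q (Comp A g f) = Comp Q (AMap q g) (AMap q f)"
    if "f \<in> Arr A" "g \<in> Arr A" "Cod A f = Dom A g" for f g
    using Q_Comp[of f "Dom A f" "Dom A g" g "Cod A g"] that by (simp add: Hom_def)
qed simp_all

text \<open>
  The quotient functor is an epimorphism of categories, being surjective on objects and on arrows.
\<close>

lemma functor_eq_quotient:
  assumes "functor_eq A (functor_comp F q) (functor_comp G q)"
  shows "functor_eq Q F G"
  unfolding functor_eq_def Q_Obj
proof (intro conjI ballI)
  show "OMap F a = OMap G a" if "a \<in> Obj A" for a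
    using assms that by (simp add: functor_eq_def functor_comp_def)
  show "AMap F X = AMap G X" if X: "X \<in> Arr Q" for X
  proof -
    obtain f where "f \<in> Arr A" "X = R `` {f}" using X unfolding Q_Arr ..
    then show ?thesis using assms by (simp add: functor_eq_def functor_comp_def)
  qed
qed

text \<open>
  An isomorphism of categories is injective on arrows, so the classes of the congruence are
  recovered from the values of \<open>\<gamma>\<close>.
\<close>

lemma congruence_unique:
  assumes "induces_isomorphism A R H \<gamma>"
  shows "R = homotopy_relation A \<gamma>"
proof -
  obtain G where G: "functor_eq A (functor_comp G q) \<gamma>" "is_cat_isomorphism Q H G"
    using assms by (auto simp: induces_isomorphism_def)
  obtain K where K: "functor_eq Q (functor_comp K G) functor_id"
    using G(2) by (auto simp: is_cat_isomorphism_def)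
  have G_class: "AMap G (R `` {f}) = AMap \<gamma> f" if "f \<in> Arr A" for f
    using G(1) that by (auto simp: functor_eq_def functor_comp_def)
  have K_class: "AMap K (AMap G (R `` {f})) = R `` {f}" if "f \<in> Arr A" for f
  proof -
    have "R `` {f} \<in> Arr Q" using that Q_Arr by blast
    then show ?thesis using K by (auto simp: functor_eq_def functor_comp_def functor_id_def)
  qed
  have inj: "AMap \<gamma> f = AMap \<gamma> g \<longleftrightarrow> (f, g) \<in> R" if "f \<in> Arr A" "g \<in> Arr A" for f g
    using class_eq_iff[OF that] G_class K_class that by metis
  show ?thesis
    using inj related_parallel by (auto simp: homotopy_relation_def)
qed

end

section \<open>Localizations that are quotients\<close>

lemma functor_HomD:
  "is_functor A B F \<Longrightarrow> f \<in> Hom A a b \<Longrightarrow> AMap F f \<in> Hom B (OMap F a) (OMap F b)"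
  by (auto simp: is_functor_def Hom_def)

lemma functor_CompD:
  "is_functor A B F \<Longrightarrow> f \<in> Hom A a b \<Longrightarrow> g \<in> Hom A b c \<Longrightarrow>
    AMap F (Comp A g f) = Comp B (AMap F g) (AMap F f)"
  by (auto simp: is_functor_def Hom_def)

lemma functor_IdentD:
  "is_functor A B F \<Longrightarrow> a \<in> Obj A \<Longrightarrow> AMap F (Ident A a) = Ident B (OMap F a)"
  by (auto simp: is_functor_def)

lemma functor_comp_is_functor:
  assumes "is_functor A B F" "is_functor B D G"
  shows "is_functor A D (functor_comp G F)"
  unfolding is_functor_def
proof (intro conjI ballI impI)
  show "AMap (functor_comp G F) f \<in> Hom D (OMap (functor_comp G F) (Dom A f)) (OMap (functor_comp G F) (Cod A f))"
    if "f \<in> Arr A" for f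
    using functor_HomD[OF assms(2) functor_HomD[OF assms(1), of f]] that
    by (simp add: functor_comp_def Hom_def)
  show "AMap (functor_comp G F) (Comp A g f) = Comp D (AMap (functor_comp G F) g) (AMap (functor_comp G F) f)"
    if fg: "f \<in> Arr A" "g \<in> Arr A" "Cod A f = Dom A g" for f g
  proof -
    have f: "f \<in> Hom A (Dom A f) (Dom A g)" and g: "g \<in> Hom A (Dom A g) (Cod A g)"
      using fg by (auto simp: Hom_def)
    show ?thesis
      using functor_CompD[OF assms(1) f g]
        functor_CompD[OF assms(2) functor_HomD[OF assms(1) f] functor_HomD[OF assms(1) g]]
      by (simp add: functor_comp_def)
  qed
qed (use assms in \<open>simp_all add: functor_comp_def is_functor_def\<close>)

lemma functor_id_is_functor: "is_functor A A functor_id"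
  by (auto simp: is_functor_def functor_id_def Hom_def)

lemma homotopy_relation_congruence:
  assumes "category A" "is_functor A H \<gamma>"
  shows "is_congruence A (homotopy_relation A \<gamma>)"
proof -
  interpret category A by fact
  have comp: "(Comp A v (Comp A f u), Comp A v (Comp A g u)) \<in> homotopy_relation A \<gamma>"
    if fg: "(f, g) \<in> homotopy_relation A \<gamma>" and uv: "u \<in> Arr A" "v \<in> Arr A"
      "Cod A u = Dom A f" "Dom A v = Cod A f" for f g u v
  proof -
    have f: "f \<in> Hom A (Cod A u) (Dom A v)" and g: "g \<in> Hom A (Cod A u) (Dom A v)"
      and eq: "AMap \<gamma> f = AMap \<gamma> g"
      using fg uv by (auto simp: homotopy_relation_def Hom_def)
    have u: "u \<in> Hom A (Dom A u) (Cod A u)" and v: "v \<in> Hom A (Dom A v) (Cod A v)"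
      using uv by (auto simp: Hom_def)
    note fu = Comp_Hom[OF u f] and gu = Comp_Hom[OF u g]
    show ?thesis
      using Comp_Hom[OF fu v] Comp_Hom[OF gu v] functor_CompD[OF assms(2) u f]
        functor_CompD[OF assms(2) u g] functor_CompD[OF assms(2) fu v]
        functor_CompD[OF assms(2) gu v] eq
      by (simp add: homotopy_relation_def Hom_def)
  qed
  have "homotopy_relation A \<gamma> \<inter> Hom A a b \<times> Hom A a b =
      {(f, g). f \<in> Hom A a b \<and> g \<in> Hom A a b \<and> AMap \<gamma> f = AMap \<gamma> g}" for a b
    by (auto simp: homotopy_relation_def Hom_def)
  moreover have "equiv X {(f, g). f \<in> X \<and> g \<in> X \<and> AMap \<gamma> f = AMap \<gamma> g}" for X
    by (rule equivI) (auto simp: refl_on_def sym_def trans_def)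
  ultimately have "equiv (Hom A a b) (homotopy_relation A \<gamma> \<inter> Hom A a b \<times> Hom A a b)" for a b
    by simp
  moreover have "\<forall>(f, g) \<in> homotopy_relation A \<gamma>.
      f \<in> Arr A \<and> g \<in> Arr A \<and> Dom A f = Dom A g \<and> Cod A f = Cod A g"
    by (simp add: homotopy_relation_def)
  ultimately show ?thesis
    using comp unfolding is_congruence_def by blast
qed

lemma localization_factors:
  fixes D :: "('q, 'k) cat"
  assumes "is_localization TYPE('q) TYPE('k) A W H \<gamma>"
    and "category D" "is_functor A D F" "\<And>w. w \<in> W \<Longrightarrow> is_iso D (AMap F w)"
  obtains G where "is_functor H D G" "functor_eq A (functor_comp G \<gamma>) F"
    "\<And>G'. is_functor H D G' \<Longrightarrow> functor_eq A (functor_comp G' \<gamma>) F \<Longrightarrow> functor_eq H G' G"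
proof -
  have "\<forall>(D :: ('q, 'k) cat) F.
      category D \<and> is_functor A D F \<and> (\<forall>w \<in> W. is_iso D (AMap F w)) \<longrightarrow>
      (\<exists>G. is_functor H D G \<and> functor_eq A (functor_comp G \<gamma>) F \<and>
        (\<forall>G'. is_functor H D G' \<and> functor_eq A (functor_comp G' \<gamma>) F \<longrightarrow> functor_eq H G' G))"
    using assms(1) unfolding is_localization_def by (elim conjE)
  from this[rule_format, of D F] show ?thesis using assms(2-4) that by blast
qed

text \<open>
  A localization is a quotient as soon as inverses of the images of \<open>W\<close> come from arrows of \<open>A\<close>.
  The universal property is used twice, each time with a test category whose types are fixed by the
  situation: with \<open>A/\<sim>\<close> to construct the inverse functor, and with \<open>H\<close> itself to see that it is an
  inverse.
\<close>

theorem localization_is_quotient: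
  fixes A :: "('o, 'm) cat" and H :: "('p, 'n) cat"
  assumes A: "category A" and W: "W \<subseteq> Arr A"
    and loc1: "is_localization TYPE('o) TYPE('m set) A W H \<gamma>"
    and loc2: "is_localization TYPE('p) TYPE('n) A W H \<gamma>"
    and inverse: "\<And>w. w \<in> W \<Longrightarrow> \<exists>v \<in> Hom A (Cod A w) (Dom A w).
      AMap \<gamma> (Comp A v w) = AMap \<gamma> (Ident A (Dom A w)) \<and>
      AMap \<gamma> (Comp A w v) = AMap \<gamma> (Ident A (Cod A w))"
  shows "induces_isomorphism A (homotopy_relation A \<gamma>) H \<gamma>"
proof -
  have H: "category H" and \<gamma>: "is_functor A H \<gamma>" and \<gamma>_iso: "\<And>w. w \<in> W \<Longrightarrow> is_iso H (AMap \<gamma> w)"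
    using loc1 by (auto simp: is_localization_def)
  define R where "R = homotopy_relation A \<gamma>"
  interpret category_congruence A R
    using A homotopy_relation_congruence[OF A \<gamma>]
    by (simp add: category_congruence_def category_congruence_axioms_def R_def)
  have R_I: "R `` {f} = R `` {g}" if "f \<in> Hom A a b" "g \<in> Hom A a b" "AMap \<gamma> f = AMap \<gamma> g" for f g a b
    using that class_eq_iff by (auto simp: R_def homotopy_relation_def Hom_def)
  \<comment> \<open>Parallel arrows with equal images under \<open>\<gamma>\<close> have the same class, so \<open>v\<close> represents an inverse.\<close>
  have q_iso: "is_iso Q (AMap q w)" if "w \<in> W" for w
  proof -
    obtain v where v: "v \<in> Hom A (Cod A w) (Dom A w)"
      "AMap \<gamma> (Comp A v w) = AMap \<gamma> (Ident A (Dom A w))"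
      "AMap \<gamma> (Comp A w v) = AMap \<gamma> (Ident A (Cod A w))"
      using inverse[OF \<open>w \<in> W\<close>] by blast
    have wA: "w \<in> Arr A" using \<open>w \<in> W\<close> W by blast
    then have w: "w \<in> Hom A (Dom A w) (Cod A w)" by (simp add: Hom_def)
    have "Comp Q (R `` {v}) (R `` {w}) = R `` {Ident A (Dom A w)}"
      using Q_Comp[OF w v(1)] R_I[OF Comp_Hom[OF w v(1)] Ident_Hom[OF Dom_Obj[OF wA]] v(2)] by simp
    moreover have "Comp Q (R `` {w}) (R `` {v}) = R `` {Ident A (Cod A w)}"
      using Q_Comp[OF v(1) w] R_I[OF Comp_Hom[OF v(1) w] Ident_Hom[OF Cod_Obj[OF wA]] v(3)] by simp
    moreover have "R `` {v} \<in> Hom Q (Cod A w) (Dom A w)" "R `` {w} \<in> Arr Q"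
      using v(1) wA Q_Hom Q_Arr by blast+
    ultimately show ?thesis using wA by (auto simp: is_iso_def)
  qed
  obtain G where G: "is_functor H Q G" "functor_eq A (functor_comp G \<gamma>) q"
    using localization_factors[OF loc1 Q_category q_functor q_iso] by metis
  \<comment> \<open>The value on a class may be read off from any representative, since \<open>\<gamma>\<close> is constant on it.\<close>
  define K :: "('o, 'm set, 'p, 'n) func"
    where "K = \<lparr>OMap = OMap \<gamma>, AMap = (\<lambda>X. AMap \<gamma> (SOME f. f \<in> X))\<rparr>"
  have homotopic: "AMap \<gamma> g = AMap \<gamma> f" if "g \<in> R `` {f}" for f g
    using that by (auto simp: R_def homotopy_relation_def)
  have K_class: "AMap K (R `` {f}) = AMap \<gamma> f" if "f \<in> Arr A" for f
  proof -
    have "(SOME g. g \<in> R `` {f}) \<in> R `` {f}"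
      by (rule someI[of _ f]) (use self_related[OF that] in simp)
    then have "AMap \<gamma> (SOME g. g \<in> R `` {f}) = AMap \<gamma> f"
      using homotopic by blast
    then show ?thesis by (simp add: K_def)
  qed
  have K_Obj: "OMap K a = OMap \<gamma> a" for a by (simp add: K_def)
  have K: "is_functor Q H K"
    unfolding is_functor_def
  proof (intro conjI ballI impI)
    show "OMap K a \<in> Obj H" if "a \<in> Obj Q" for a
      using that \<gamma> by (simp add: K_def is_functor_def)
    show "AMap K (Ident Q a) = Ident H (OMap K a)" if "a \<in> Obj Q" for a
      using that K_class[of "Ident A a"] Ident_Hom[of a] functor_IdentD[OF \<gamma>, of a]
      by (simp add: K_Obj Hom_def)
    show "AMap K X \<in> Hom H (OMap K (Dom Q X)) (OMap K (Cod Q X))" if X: "X \<in> Arr Q" for X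
    proof -
      obtain f where f: "f \<in> Arr A" "X = R `` {f}" using X Q_Arr by blast
      then have "AMap \<gamma> f \<in> Hom H (OMap \<gamma> (Dom A f)) (OMap \<gamma> (Cod A f))"
        by (intro functor_HomD[OF \<gamma>]) (simp add: Hom_def)
      then show ?thesis
        unfolding f(2) K_class[OF f(1)] Q_Dom_Cod[OF f(1)] K_Obj .
    qed
    show "AMap K (Comp Q Y X) = Comp H (AMap K Y) (AMap K X)"
      if XY: "X \<in> Arr Q" "Y \<in> Arr Q" "Cod Q X = Dom Q Y" for X Y
    proof -
      have "X \<in> Hom Q (Dom Q X) (Dom Q Y)" "Y \<in> Hom Q (Dom Q Y) (Cod Q Y)"
        using XY by (auto simp: Hom_def)
      then obtain f g where f: "f \<in> Hom A (Dom Q X) (Dom Q Y)" "X = R `` {f}"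
        and g: "g \<in> Hom A (Dom Q Y) (Cod Q Y)" "Y = R `` {g}" using Q_Hom by meson
      have arr: "f \<in> Arr A" "g \<in> Arr A" "Comp A g f \<in> Arr A"
        using f(1) g(1) Comp_Hom[OF f(1) g(1)] by (auto simp: Hom_def)
      have "AMap K (Comp Q Y X) = AMap \<gamma> (Comp A g f)"
        using Q_Comp[OF f(1) g(1)] K_class[OF arr(3)] f(2) g(2) by simp
      then show ?thesis
        using functor_CompD[OF \<gamma> f(1) g(1)] K_class[OF arr(1)] K_class[OF arr(2)] f(2) g(2) by simp
    qed
  qed
  have Kq: "functor_eq A (functor_comp K q) \<gamma>"
    using K_class by (auto simp: functor_eq_def functor_comp_def K_def)
  have GK: "functor_eq Q (functor_comp G K) functor_id"
  proof (rule functor_eq_quotient)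
    show "functor_eq A (functor_comp (functor_comp G K) q) (functor_comp functor_id q)"
      using G(2) Kq by (auto simp: functor_eq_def functor_comp_def functor_id_def)
  qed
  have KG: "functor_eq H (functor_comp K G) functor_id"
  proof -
    \<comment> \<open>Both \<open>K G\<close> and the identity are factorizations of \<open>\<gamma>\<close> through itself.\<close>
    obtain J where J: "\<And>J'. is_functor H H J' \<Longrightarrow> functor_eq A (functor_comp J' \<gamma>) \<gamma> \<Longrightarrow> functor_eq H J' J"
      using localization_factors[OF loc2 H \<gamma> \<gamma>_iso] by metis
    have "functor_eq A (functor_comp (functor_comp K G) \<gamma>) \<gamma>"
      using G(2) Kq by (auto simp: functor_eq_def functor_comp_def)
    then have "functor_eq H (functor_comp K G) J"
      using J functor_comp_is_functor[OF G(1) K] by blast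
    moreover have "functor_eq H functor_id J"
      by (rule J[OF functor_id_is_functor]) (simp add: functor_eq_def functor_comp_def functor_id_def)
    ultimately show ?thesis by (auto simp: functor_eq_def)
  qed
  have "is_cat_isomorphism Q H K"
    unfolding is_cat_isomorphism_def using K G(1) GK KG by blast
  then show ?thesis
    unfolding induces_isomorphism_def R_def[symmetric] using K Kq by blast
qed

section \<open>Weak equivalences between fibrant-cofibrant objects\<close>

lemma full_subcategory_Hom:
  "f \<in> Hom (full_subcategory C S) a b \<longleftrightarrow> f \<in> Hom C a b \<and> a \<in> S \<and> b \<in> S"
  by (auto simp: full_subcategory_def Hom_def)

lemma full_subcategory_category:
  assumes "category C"
  shows "category (full_subcategory C S)"
proof -
  interpret category C by fact
  let ?S = "full_subcategory C S"
  have simps: "Comp ?S = Comp C" "Ident ?S = Ident C" "Obj ?S = Obj C \<inter> S"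
    "Dom ?S = Dom C" "Cod ?S = Cod C" "f \<in> Arr ?S \<longleftrightarrow> f \<in> Arr C \<and> Dom C f \<in> S \<and> Cod C f \<in> S" for f
    by (auto simp: full_subcategory_def)
  show ?thesis
  proof (unfold_locales, unfold full_subcategory_Hom simps)
    show "Ident C a \<in> Hom C a a \<and> a \<in> S \<and> a \<in> S" if "a \<in> Obj C \<inter> S" for a
      using that Ident_Hom by blast
    show "Comp C g f \<in> Hom C a c \<and> a \<in> S \<and> c \<in> S"
      if "f \<in> Hom C a b \<and> a \<in> S \<and> b \<in> S" "g \<in> Hom C b c \<and> b \<in> S \<and> c \<in> S" for f g a b c
      using that Comp_Hom by blast
    show "Comp C f (Ident C a) = f" "Comp C (Ident C b) f = f"
      if "f \<in> Hom C a b \<and> a \<in> S \<and> b \<in> S" for f a b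
      using that Comp_Ident_left Comp_Ident_right by blast+
    show "Comp C h (Comp C g f) = Comp C (Comp C h g) f"
      if "f \<in> Hom C a b \<and> a \<in> S \<and> b \<in> S" "g \<in> Hom C b c \<and> b \<in> S \<and> c \<in> S"
        "h \<in> Hom C c d \<and> c \<in> S \<and> d \<in> S" for f g h a b c d
      using that Comp_assoc by blast
  qed (simp_all add: Dom_Obj Cod_Obj)
qed

lemma opposite_simps [simp]:
  "Obj (opposite C) = Obj C" "Arr (opposite C) = Arr C" "Dom (opposite C) = Cod C"
  "Cod (opposite C) = Dom C" "Ident (opposite C) = Ident C" "Comp (opposite C) g f = Comp C f g"
  "Hom (opposite C) a b = Hom C b a" "opposite (opposite C) = C"
  by (auto simp: opposite_def Hom_def)

text \<open>
  The axioms of a model category are self-dual. In the opposite category fibrations and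
  cofibrations trade places, as do the two lifting axioms, so each fact about fibrations below yields
  its dual.
\<close>

lemma opposite_has_lifting:
  assumes "has_lifting C i p"
  shows "has_lifting (opposite C) p i"
  unfolding has_lifting_def opposite_simps
proof (intro ballI impI)
  fix u v assume "u \<in> Hom C (Cod C i) (Cod C p)" "v \<in> Hom C (Dom C i) (Dom C p)"
    "Comp C u i = Comp C p v"
  then obtain h where "h \<in> Hom C (Cod C i) (Dom C p)" "Comp C h i = v" "Comp C p h = u"
    using assms unfolding has_lifting_def by force
  then show "\<exists>h \<in> Hom C (Cod C i) (Dom C p). Comp C p h = u \<and> Comp C h i = v" by blast
qed

lemma opposite_is_retract_of:
  assumes "is_retract_of (opposite C) f g"
  shows "is_retract_of C f g"
proof -
  obtain i r j s where "f \<in> Arr C" "g \<in> Arr C" "i \<in> Hom C (Cod C g) (Cod C f)"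
    "r \<in> Hom C (Cod C f) (Cod C g)" "j \<in> Hom C (Dom C g) (Dom C f)" "s \<in> Hom C (Dom C f) (Dom C g)"
    "Comp C i r = Ident C (Cod C f)" "Comp C j s = Ident C (Dom C f)"
    "Comp C i g = Comp C f j" "Comp C r f = Comp C g s"
    using assms unfolding is_retract_of_def opposite_simps by blast
  then show ?thesis
    unfolding is_retract_of_def
    by (intro conjI bexI[of _ s] bexI[of _ j] bexI[of _ r] bexI[of _ i]) simp_all
qed

lemma opposite_cofibrant: "cofibrant (opposite C) Fib x \<longleftrightarrow> fibrant C Fib x"
  and opposite_fibrant: "fibrant (opposite C) Cof x \<longleftrightarrow> cofibrant C Cof x"
  by (simp_all add: cofibrant_def fibrant_def is_initial_def is_terminal_def)

context model_category
begin

lemma opposite_model_category: "model_category (opposite C) We Cof Fib"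
proof (unfold_locales, unfold opposite_simps)
  show "has_finite_limits (opposite C)" "has_finite_colimits (opposite C)"
    using finite_limits finite_colimits by (simp_all add: has_finite_colimits_def)
  show "We \<subseteq> Arr C" "Cof \<subseteq> Arr C" "Fib \<subseteq> Arr C" by (rule classes)+
  show "Comp C f g \<in> We" if "f \<in> Hom C b a" "g \<in> Hom C c b" "f \<in> We" "g \<in> We" for f g a b c
    using two_of_three(1)[OF that(2,1,4,3)] .
  show "g \<in> We" if "f \<in> Hom C b a" "g \<in> Hom C c b" "f \<in> We" "Comp C f g \<in> We" for f g a b c
    using two_of_three(3)[OF that(2,1,3,4)] .
  show "f \<in> We" if "f \<in> Hom C b a" "g \<in> Hom C c b" "g \<in> We" "Comp C f g \<in> We" for f g a b c
    using two_of_three(2)[OF that(2,1,3,4)] .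
  show "f \<in> We" if "is_retract_of (opposite C) f g" "g \<in> We" for f g
    by (rule retracts(1)[OF opposite_is_retract_of[OF that(1)] that(2)])
  show "f \<in> Cof" if "is_retract_of (opposite C) f g" "g \<in> Cof" for f g
    by (rule retracts(3)[OF opposite_is_retract_of[OF that(1)] that(2)])
  show "f \<in> Fib" if "is_retract_of (opposite C) f g" "g \<in> Fib" for f g
    by (rule retracts(2)[OF opposite_is_retract_of[OF that(1)] that(2)])
  show "has_lifting (opposite C) i p" if "i \<in> Fib \<inter> We" "p \<in> Cof" for i p
    by (rule opposite_has_lifting[OF lifting(2)[OF that(2,1)]])
  show "has_lifting (opposite C) i p" if "i \<in> Fib" "p \<in> Cof \<inter> We" for i p
    by (rule opposite_has_lifting[OF lifting(1)[OF that(2,1)]])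
  show "\<exists>c. \<exists>i \<in> Hom C c a. \<exists>p \<in> Hom C b c. i \<in> Fib \<inter> We \<and> p \<in> Cof \<and> Comp C i p = f"
    if "f \<in> Hom C b a" for f a b
    using factorization(2)[OF that] by fast
  show "\<exists>c. \<exists>i \<in> Hom C c a. \<exists>p \<in> Hom C b c. i \<in> Fib \<and> p \<in> Cof \<inter> We \<and> Comp C i p = f"
    if "f \<in> Hom C b a" for f a b
    using factorization(1)[OF that] by blast
qed (auto intro: Dom_Obj Cod_Obj Ident_Hom Comp_Hom Comp_Ident_left Comp_Ident_right
    simp: Comp_assoc)

text \<open>
  The retract argument: factor \<open>f\<close> as a trivial cofibration \<open>i\<close> followed by a fibration \<open>p\<close>. Lifting
  \<open>i\<close> against \<open>f\<close> exhibits \<open>f\<close> as a retract of \<open>p\<close>.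
\<close>

lemma fibrationI:
  assumes f: "f \<in> Hom C a b" and lift: "\<And>i. i \<in> Cof \<inter> We \<Longrightarrow> has_lifting C i f"
  shows "f \<in> Fib"
proof -
  obtain c i p where i: "i \<in> Hom C a c" "i \<in> Cof \<inter> We" and p: "p \<in> Hom C c b" "p \<in> Fib"
    and f_eq: "Comp C p i = f"
    using factorization(1)[OF f] by blast
  have a: "a \<in> Obj C" and b: "b \<in> Obj C" using f Dom_Obj Cod_Obj by (auto simp: Hom_def)
  have dc: "Dom C i = a" "Cod C i = c" "Dom C f = a" "Cod C f = b" "Dom C p = c" "Cod C p = b"
    "f \<in> Arr C" "p \<in> Arr C"
    using i(1) f p(1) by (auto simp: Hom_def)
  have "Comp C f (Ident C a) = Comp C p i"
    using Comp_Ident_right[OF f] f_eq by simp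
  then obtain h where h: "h \<in> Hom C c a" "Comp C h i = Ident C a" "Comp C f h = p"
    using lift[OF i(2)] Ident_Hom[OF a] p(1) unfolding has_lifting_def dc by blast
  have "is_retract_of C f p"
    unfolding is_retract_of_def dc
  proof (intro conjI bexI)
    show "Comp C h i = Ident C a" by fact
    show "Comp C (Ident C b) (Ident C b) = Ident C b" by (rule Comp_Ident_left[OF Ident_Hom[OF b]])
    show "Comp C p i = Comp C (Ident C b) f" using f_eq Comp_Ident_left[OF f] by simp
    show "Comp C f h = Comp C (Ident C b) p" using h(3) Comp_Ident_left[OF p(1)] by simp
  qed (use dc i h Ident_Hom[OF b] in auto)
  then show ?thesis using retracts(2) p(2) by blast
qed

text \<open>
  Closure under composition is not an axiom; it holds because fibrations are recognized
  by lifting, and lifts against a composite are found by lifting first through \<open>g\<close>, then through \<open>f\<close>.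
\<close>

lemma fibration_comp:
  assumes f: "f \<in> Hom C a b" "f \<in> Fib" and g: "g \<in> Hom C b c" "g \<in> Fib"
  shows "Comp C g f \<in> Fib"
proof (rule fibrationI[OF Comp_Hom[OF f(1) g(1)]])
  fix i assume i: "i \<in> Cof \<inter> We"
  let ?x = "Dom C i" and ?y = "Cod C i"
  have iH: "i \<in> Hom C ?x ?y" using i classes by (auto simp: Hom_def)
  have dc: "Dom C f = a" "Cod C f = b" "Dom C g = b" "Cod C g = c"
    "Dom C (Comp C g f) = a" "Cod C (Comp C g f) = c"
    using f(1) g(1) Comp_Hom[OF f(1) g(1)] by (auto simp: Hom_def)
  show "has_lifting C i (Comp C g f)"
    unfolding has_lifting_def dc
  proof (intro ballI impI)
    fix u v assume u: "u \<in> Hom C ?x a" and v: "v \<in> Hom C ?y c"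
      and sq: "Comp C (Comp C g f) u = Comp C v i"
    have "Comp C g (Comp C f u) = Comp C v i"
      using sq Comp_assoc[OF u f(1) g(1)] by simp
    then obtain k where k: "k \<in> Hom C ?y b" "Comp C k i = Comp C f u" "Comp C g k = v"
      using lifting(1)[OF i g(2)] Comp_Hom[OF u f(1)] v unfolding has_lifting_def dc by blast
    obtain h where h: "h \<in> Hom C ?y a" "Comp C h i = u" "Comp C f h = k"
      using lifting(1)[OF i f(2)] u k(1) k(2)[symmetric] unfolding has_lifting_def dc by blast
    have "Comp C (Comp C g f) h = v"
      using Comp_assoc[OF h(1) f(1) g(1)] h(3) k(3) by simp
    then show "\<exists>h \<in> Hom C ?y a. Comp C h i = u \<and> Comp C (Comp C g f) h = v"
      using h by blast
  qed
qed

lemma fibrant_if_fibration: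
  assumes p: "p \<in> Hom C z b" "p \<in> Fib" and b: "fibrant C Fib b"
  shows "fibrant C Fib z"
proof -
  obtain t g where "is_terminal C t" "g \<in> Hom C b t" "g \<in> Fib"
    using b by (auto simp: fibrant_def)
  then show ?thesis
    using fibration_comp[OF p] Comp_Hom[OF p(1)] Dom_Obj p(1)
    by (auto simp: fibrant_def Hom_def)
qed

lemma cofibrant_if_cofibration:
  assumes "i \<in> Hom C a z" "i \<in> Cof" "cofibrant C Cof a"
  shows "cofibrant C Cof z"
  using model_category.fibrant_if_fibration[OF opposite_model_category, of i z a] assms
  by (simp add: opposite_fibrant)

text \<open>
  The section is a lift of the identity of \<open>b\<close> against the cofibration from an initial object; the
  square commutes because its corner is initial.
\<close>

lemma trivial_fibration_section:
  assumes p: "p \<in> Hom C z b" "p \<in> Fib \<inter> We" and b: "cofibrant C Cof b"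
  shows "\<exists>s \<in> Hom C b z. Comp C p s = Ident C b"
proof -
  obtain e i where e: "is_initial C e" and i: "i \<in> Hom C e b" "i \<in> Cof"
    using b by (auto simp: cofibrant_def)
  have z: "z \<in> Obj C" and bO: "b \<in> Obj C" using p(1) Dom_Obj Cod_Obj by (auto simp: Hom_def)
  obtain u where u: "u \<in> Hom C e z" using e z by (auto simp: is_initial_def)
  have dc: "Dom C p = z" "Cod C p = b" "Dom C i = e" "Cod C i = b"
    using p(1) i(1) by (auto simp: Hom_def)
  have "Comp C p u = i"
    using e bO i(1) Comp_Hom[OF u p(1)] unfolding is_initial_def by blast
  then have "Comp C p u = Comp C (Ident C b) i"
    using Comp_Ident_left[OF i(1)] by simp
  then show ?thesis
    using lifting(2)[OF i(2) p(2)] u Ident_Hom[OF bO] unfolding has_lifting_def dc by blast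
qed

lemma trivial_cofibration_retraction:
  assumes "i \<in> Hom C a z" "i \<in> Cof \<inter> We" "fibrant C Fib a"
  shows "\<exists>r \<in> Hom C z a. Comp C r i = Ident C a"
  using model_category.trivial_fibration_section[OF opposite_model_category, of i z a] assms
  by (simp add: opposite_cofibrant)

text \<open>
  The middle object \<open>z\<close> inherits fibrancy from \<open>b\<close> along \<open>p\<close> and cofibrancy from \<open>a\<close> along \<open>i\<close>.
  Hence \<open>i\<close> and \<open>p\<close> are themselves weak equivalences between fibrant-cofibrant objects, so the
  localization inverts each of them.
\<close>

lemma cf_weak_equivalence_factorization:
  assumes w: "w \<in> Hom C a b" "w \<in> We"
    and a: "fibrant C Fib a" "cofibrant C Cof a" and b: "fibrant C Fib b" "cofibrant C Cof b"
  obtains z i p r s where "fibrant C Fib z" "cofibrant C Cof z"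
    "i \<in> Hom C a z" "i \<in> We" "p \<in> Hom C z b" "p \<in> We" "Comp C p i = w"
    "r \<in> Hom C z a" "Comp C r i = Ident C a" "s \<in> Hom C b z" "Comp C p s = Ident C b"
proof -
  obtain z i p where i: "i \<in> Hom C a z" "i \<in> Cof \<inter> We" and p: "p \<in> Hom C z b" "p \<in> Fib"
    and eq: "Comp C p i = w"
    using factorization(1)[OF w(1)] by blast
  have pW: "p \<in> We" using two_of_three(2)[OF i(1) p(1)] i(2) eq w(2) by blast
  show ?thesis
    using that[OF fibrant_if_fibration[OF p b(1)] cofibrant_if_cofibration[OF i(1) _ a(2)] i(1) _ p(1) pW eq]
      trivial_cofibration_retraction[OF i a(1)] trivial_fibration_section[OF p(1) _ b(2)] p(2) i(2) pW
    by blast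
qed

end

text \<open>
  A retraction of an isomorphism and a section of an isomorphism are two-sided inverses.
\<close>

lemma (in category) iso_section_retraction_inverse:
  assumes i: "i \<in> Hom C a z" "is_iso C i" and p: "p \<in> Hom C z b" "is_iso C p"
    and r: "r \<in> Hom C z a" "Comp C r i = Ident C a" and s: "s \<in> Hom C b z" "Comp C p s = Ident C b"
  shows "Comp C (Comp C r s) (Comp C p i) = Ident C a" "Comp C (Comp C p i) (Comp C r s) = Ident C b"
proof -
  have "inv_arrow C i = r"
    using inverse_unique[OF i(1) r(1) inv_arrow(1)[OF i(2,1)] r(2) inv_arrow(3)[OF i(2,1)]] by simp
  then have ir: "Comp C i r = Ident C z" using inv_arrow(3)[OF i(2,1)] by simp
  have "inv_arrow C p = s"
    by (rule inverse_unique[OF p(1) inv_arrow(1)[OF p(2,1)] s(1) inv_arrow(2)[OF p(2,1)] s(2)])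
  then have sp: "Comp C s p = Ident C z" using inv_arrow(2)[OF p(2,1)] by simp
  note pi = Comp_Hom[OF i(1) p(1)] and rs = Comp_Hom[OF s(1) r(1)]
  show "Comp C (Comp C r s) (Comp C p i) = Ident C a"
    using Comp_assoc[OF pi s(1) r(1)] Comp_assoc[OF i(1) p(1) s(1)] sp Comp_Ident_left[OF i(1)] r(2)
    by simp
  show "Comp C (Comp C p i) (Comp C r s) = Ident C b"
    using Comp_assoc[OF rs i(1) p(1)] Comp_assoc[OF s(1) r(1) i(1)] ir Comp_Ident_left[OF s(1)] s(2)
    by simp
qed

theorem corollary3p1p23:
  fixes C :: "('o, 'm) cat"
    and We Fib Cof :: "'m set"
    and H :: "('p, 'n) cat"
    and \<gamma> :: "('o, 'm, 'p, 'n) func"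
  defines "Ccf \<equiv> cf_subcategory C Fib Cof"
    and "W \<equiv> cf_weak_equivalences C We Fib Cof"
  assumes "model_category C We Fib Cof"
    and "is_localization TYPE('o) TYPE('m set) Ccf W H \<gamma>"
    and "is_localization TYPE('p) TYPE('n) Ccf W H \<gamma>"
  shows "(is_congruence Ccf (homotopy_relation Ccf \<gamma>) \<and>
          induces_isomorphism Ccf (homotopy_relation Ccf \<gamma>) H \<gamma>) \<and>
         (\<forall>R. is_congruence Ccf R \<and> induces_isomorphism Ccf R H \<gamma> \<longrightarrow>
              R = homotopy_relation Ccf \<gamma>)"
proof (intro conjI allI impI)
  interpret model_category C We Fib Cof by fact
  have cat: "category Ccf"
    unfolding Ccf_def cf_subcategory_def by (rule full_subcategory_category) (rule category_axioms)
  have \<gamma>: "is_functor Ccf H \<gamma>" and H: "category H" and \<gamma>_iso: "\<And>w. w \<in> W \<Longrightarrow> is_iso H (AMap \<gamma> w)"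
    using assms(4) unfolding is_localization_def by blast+
  interpret cf: category Ccf by (rule cat)
  interpret H: category H by (rule H)
  have cf_Hom: "f \<in> Hom Ccf a b \<longleftrightarrow> f \<in> Hom C a b \<and> fibrant C Fib a \<and> cofibrant C Cof a \<and>
      fibrant C Fib b \<and> cofibrant C Cof b" for f a b
    unfolding Ccf_def cf_subcategory_def full_subcategory_Hom by simp
  have cf_simps: "Comp Ccf = Comp C" "Ident Ccf = Ident C" "Dom Ccf = Dom C" "Cod Ccf = Cod C"
    by (simp_all add: Ccf_def cf_subcategory_def full_subcategory_def)
  have W_iff: "f \<in> W \<longleftrightarrow> f \<in> We \<and> f \<in> Arr Ccf" for f
    by (simp add: W_def cf_weak_equivalences_def Ccf_def)
  show "is_congruence Ccf (homotopy_relation Ccf \<gamma>)"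
    by (rule homotopy_relation_congruence[OF cat \<gamma>])
  show "induces_isomorphism Ccf (homotopy_relation Ccf \<gamma>) H \<gamma>"
  proof (rule localization_is_quotient[OF cat _ assms(4,5)])
    show "W \<subseteq> Arr Ccf" using W_iff by blast
    fix w assume w: "w \<in> W"
    define a b where "a = Dom Ccf w" and "b = Cod Ccf w"
    have wH: "w \<in> Hom Ccf a b" and wW: "w \<in> We"
      using w W_iff by (auto simp: Hom_def a_def b_def)
    obtain z i p r s where z: "fibrant C Fib z" "cofibrant C Cof z"
      and i: "i \<in> Hom C a z" "i \<in> We" and p: "p \<in> Hom C z b" "p \<in> We" and eq: "Comp C p i = w"
      and r: "r \<in> Hom C z a" "Comp C r i = Ident C a" and s: "s \<in> Hom C b z" "Comp C p s = Ident C b"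
      using cf_weak_equivalence_factorization[of w a b] wH wW unfolding cf_Hom by metis
    have iH: "i \<in> Hom Ccf a z" and pH: "p \<in> Hom Ccf z b" and rH: "r \<in> Hom Ccf z a"
      and sH: "s \<in> Hom Ccf b z"
      using wH z i p r s cf_Hom by auto
    have ab: "a \<in> Obj Ccf" "b \<in> Obj Ccf"
      using wH cf.Dom_Obj cf.Cod_Obj by (auto simp: Hom_def)
    have iso: "is_iso H (AMap \<gamma> i)" "is_iso H (AMap \<gamma> p)"
      using \<gamma>_iso W_iff iH pH i(2) p(2) by (auto simp: Hom_def)
    note F = functor_HomD[OF \<gamma>] and FC = functor_CompD[OF \<gamma>, unfolded cf_simps]
      and FI = functor_IdentD[OF \<gamma>, unfolded cf_simps]
    have ri: "Comp H (AMap \<gamma> r) (AMap \<gamma> i) = Ident H (OMap \<gamma> a)"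
      using FC[OF iH rH] r(2) FI[OF ab(1)] by simp
    have ps: "Comp H (AMap \<gamma> p) (AMap \<gamma> s) = Ident H (OMap \<gamma> b)"
      using FC[OF sH pH] s(2) FI[OF ab(2)] by simp
    note inv = H.iso_section_retraction_inverse[OF F[OF iH] iso(1) F[OF pH] iso(2) F[OF rH] ri F[OF sH] ps]
    have rs: "Comp C r s \<in> Hom Ccf b a" using cf.Comp_Hom[OF sH rH] by (simp add: cf_simps)
    have "AMap \<gamma> w = Comp H (AMap \<gamma> p) (AMap \<gamma> i)" using FC[OF iH pH] eq by simp
    then have "AMap \<gamma> (Comp C (Comp C r s) w) = Ident H (OMap \<gamma> a)"
      "AMap \<gamma> (Comp C w (Comp C r s)) = Ident H (OMap \<gamma> b)"
      using FC[OF wH rs] FC[OF rs wH] FC[OF sH rH] inv by simp_all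
    then show "\<exists>v \<in> Hom Ccf (Cod Ccf w) (Dom Ccf w).
        AMap \<gamma> (Comp Ccf v w) = AMap \<gamma> (Ident Ccf (Dom Ccf w)) \<and>
        AMap \<gamma> (Comp Ccf w v) = AMap \<gamma> (Ident Ccf (Cod Ccf w))"
      unfolding a_def[symmetric] b_def[symmetric] unfolding cf_simps
      using rs FI[OF ab(1)] FI[OF ab(2)] by (intro bexI[of _ "Comp C r s"]) simp_all
  qed
  fix R assume R: "is_congruence Ccf R \<and> induces_isomorphism Ccf R H \<gamma>"
  interpret category_congruence Ccf R
    using R cat by (simp add: category_congruence_def category_congruence_axioms_def)
  show "R = homotopy_relation Ccf \<gamma>"
    using R by (intro congruence_unique) (rule conjunct2)
qed

end
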